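(* Let $\mathbb{J}$ be a small category. If colimits of shape $\mathbb{J}$ commute with pullbacks in $\mathbf{Set}$, then $\mathbb{J}$ is pseudo-filtered.
   Context: For small categories $\mathbb{I}$ and $\mathbb{J}$, limits of shape $\mathbb{I}$ commute with colimits of shape $\mathbb{J}$ in $\mathbf{Set}$ if, for every functor $F:\mathbb{I}\times\mathbb{J}\to\mathbf{Set}$, the canonical map $\operatorname{colim}_{j\in\mathbb{J}}\lim_{i\in\mathbb{I}}F(i,j)\to\lim_{i\in\mathbb{I}}\operatorname{colim}_{j\in\mathbb{J}}F(i,j)$ is a bijection. Colimits of shape $\mathbb{J}$ commute with pullbacks if this holds when $\mathbb{I}=(\bullet\rightarrow\bullet\leftarrow\bullet)$ is the cospan category. A category is pseudo-filtered if each of its connected components is a filtered category (the empty category, having no connected components, is pseudo-filtered). *)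

theory Defs
  imports "HOL-Library.FuncSet" "HOL-Library.Equipollence"
begin

section \<open>Small categories\<close>

text \<open>Objects and arrows are collected in sets, so every category here is small.
  \<open>Compose C g f\<close> is the composite \<open>g \<circ> f\<close>, first \<open>f\<close> and then \<open>g\<close>.\<close>

record ('o, 'a) cat =
  Obj :: "'o set"
  Arr :: "'a set"
  Dom :: "'a \<Rightarrow> 'o"
  Cod :: "'a \<Rightarrow> 'o"
  Ident :: "'o \<Rightarrow> 'a"
  Compose :: "'a \<Rightarrow> 'a \<Rightarrow> 'a"

definition Hom :: "('o, 'a) cat \<Rightarrow> 'o \<Rightarrow> 'o \<Rightarrow> 'a set" where
  "Hom C x y = {f \<in> Arr C. Dom C f = x \<and> Cod C f = y}"

locale category =
  fixes C :: "('o, 'a) cat"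
  assumes Dom_in: "f \<in> Arr C \<Longrightarrow> Dom C f \<in> Obj C"
    and Cod_in: "f \<in> Arr C \<Longrightarrow> Cod C f \<in> Obj C"
    and Ident_in: "x \<in> Obj C \<Longrightarrow> Ident C x \<in> Hom C x x"
    and Compose_in: "f \<in> Hom C x y \<Longrightarrow> g \<in> Hom C y z \<Longrightarrow> Compose C g f \<in> Hom C x z"
    and Ident_right: "f \<in> Hom C x y \<Longrightarrow> Compose C f (Ident C x) = f"
    and Ident_left: "f \<in> Hom C x y \<Longrightarrow> Compose C (Ident C y) f = f"
    and Compose_assoc: "f \<in> Hom C w x \<Longrightarrow> g \<in> Hom C x y \<Longrightarrow> h \<in> Hom C y z \<Longrightarrow>
      Compose C h (Compose C g f) = Compose C (Compose C h g) f"

definition prod_cat :: "('i, 'b) cat \<Rightarrow> ('j, 'c) cat \<Rightarrow> ('i \<times> 'j, 'b \<times> 'c) cat" where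
  "prod_cat I J =
    \<lparr> Obj = Obj I \<times> Obj J, Arr = Arr I \<times> Arr J,
      Dom = map_prod (Dom I) (Dom J), Cod = map_prod (Cod I) (Cod J),
      Ident = map_prod (Ident I) (Ident J),
      Compose = (\<lambda>(g, g') (f, f'). (Compose I g f, Compose J g' f')) \<rparr>"

definition full_subcat :: "('o, 'a) cat \<Rightarrow> 'o set \<Rightarrow> ('o, 'a) cat" where
  "full_subcat C S = C\<lparr>Obj := S, Arr := {f \<in> Arr C. Dom C f \<in> S \<and> Cod C f \<in> S}\<rparr>"

datatype cospan_obj = Left | Mid | Right

datatype cospan_arr = Idarr cospan_obj | From_Left | From_Right

primrec cospan_dom :: "cospan_arr \<Rightarrow> cospan_obj" where
  "cospan_dom (Idarr x) = x"
| "cospan_dom From_Left = Left"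
| "cospan_dom From_Right = Right"

primrec cospan_cod :: "cospan_arr \<Rightarrow> cospan_obj" where
  "cospan_cod (Idarr x) = x"
| "cospan_cod From_Left = Mid"
| "cospan_cod From_Right = Mid"

text \<open>In a composable pair of arrows of \<open>Left \<rightarrow> Mid \<leftarrow> Right\<close> at least one is an identity.\<close>

primrec cospan_compose :: "cospan_arr \<Rightarrow> cospan_arr \<Rightarrow> cospan_arr" where
  "cospan_compose (Idarr x) f = f"
| "cospan_compose From_Left f = From_Left"
| "cospan_compose From_Right f = From_Right"

definition cospan :: "(cospan_obj, cospan_arr) cat" where
  "cospan = \<lparr> Obj = UNIV, Arr = UNIV, Dom = cospan_dom, Cod = cospan_cod,
    Ident = Idarr, Compose = cospan_compose \<rparr>"


section \<open>Connected components and filteredness\<close>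

definition connected_rel :: "('o, 'a) cat \<Rightarrow> 'o rel" where
  "connected_rel C =
    (let r = {(Dom C f, Cod C f) | f. f \<in> Arr C} in (r \<union> r\<inverse>)\<^sup>*)"

definition components :: "('o, 'a) cat \<Rightarrow> 'o set set" where
  "components C = Obj C // connected_rel C"

definition filtered :: "('o, 'a) cat \<Rightarrow> bool" where
  "filtered C \<longleftrightarrow>
    Obj C \<noteq> {} \<and>
    (\<forall>x\<in>Obj C. \<forall>y\<in>Obj C. \<exists>z\<in>Obj C. Hom C x z \<noteq> {} \<and> Hom C y z \<noteq> {}) \<and>
    (\<forall>x\<in>Obj C. \<forall>y\<in>Obj C. \<forall>f\<in>Hom C x y. \<forall>g\<in>Hom C x y.
      \<exists>z\<in>Obj C. \<exists>h\<in>Hom C y z. Compose C h f = Compose C h g)"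

definition pseudo_filtered :: "('o, 'a) cat \<Rightarrow> bool" where
  "pseudo_filtered C \<longleftrightarrow> (\<forall>S\<in>components C. filtered (full_subcat C S))"


section \<open>Set-valued functors, limits and colimits\<close>

text \<open>The objects of the category of sets are represented by the sets over a type \<open>'u\<close>. The
  action of a functor on an arrow is only meaningful on the set assigned to the domain.\<close>

record ('o, 'a, 'u) set_fun =
  fobj :: "'o \<Rightarrow> 'u set"
  farr :: "'a \<Rightarrow> 'u \<Rightarrow> 'u"

locale set_functor =
  fixes C :: "('o, 'a) cat" and F :: "('o, 'a, 'u) set_fun"
  assumes farr_in: "f \<in> Hom C x y \<Longrightarrow> a \<in> fobj F x \<Longrightarrow> farr F f a \<in> fobj F y"
    and farr_Ident: "x \<in> Obj C \<Longrightarrow> a \<in> fobj F x \<Longrightarrow> farr F (Ident C x) a = a"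
    and farr_Compose: "f \<in> Hom C x y \<Longrightarrow> g \<in> Hom C y z \<Longrightarrow> a \<in> fobj F x \<Longrightarrow>
      farr F (Compose C g f) a = farr F g (farr F f a)"

text \<open>The limit is the set of compatible families; the colimit is the quotient of the disjoint
  union by the equivalence relation generated by \<open>(j, a) \<sim> (j', F f a)\<close> for \<open>f : j \<rightarrow> j'\<close>.\<close>

definition limit :: "('o, 'a) cat \<Rightarrow> ('o, 'a, 'u) set_fun \<Rightarrow> ('o \<Rightarrow> 'u) set" where
  "limit C F = {s \<in> PiE (Obj C) (fobj F). \<forall>f\<in>Arr C. farr F f (s (Dom C f)) = s (Cod C f)}"

definition colimit_rel :: "('o, 'a) cat \<Rightarrow> ('o, 'a, 'u) set_fun \<Rightarrow> ('o \<times> 'u) rel" where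
  "colimit_rel C F =
    (let r = {((Dom C f, a), (Cod C f, farr F f a)) | f a. f \<in> Arr C \<and> a \<in> fobj F (Dom C f)}
     in (r \<union> r\<inverse>)\<^sup>*)"

definition colimit :: "('o, 'a) cat \<Rightarrow> ('o, 'a, 'u) set_fun \<Rightarrow> ('o \<times> 'u) set set" where
  "colimit C F = (SIGMA x:Obj C. fobj F x) // colimit_rel C F"

text \<open>The maps induced on limits and on colimits by a natural transformation with components
  \<open>\<alpha> x\<close>. In the second case \<open>G\<close> is the target functor; the union over the representatives
  \<open>(x, a)\<close> of a class is the common class of all the \<open>(x, \<alpha> x a)\<close>.\<close>

definition limit_map :: "('o, 'a) cat \<Rightarrow> ('o \<Rightarrow> 'u \<Rightarrow> 'v) \<Rightarrow> ('o \<Rightarrow> 'u) \<Rightarrow> ('o \<Rightarrow> 'v)" where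
  "limit_map C \<alpha> s = (\<lambda>x\<in>Obj C. \<alpha> x (s x))"

definition colimit_map ::
    "('o, 'a) cat \<Rightarrow> ('o, 'a, 'v) set_fun \<Rightarrow> ('o \<Rightarrow> 'u \<Rightarrow> 'v) \<Rightarrow> ('o \<times> 'u) set \<Rightarrow> ('o \<times> 'v) set" where
  "colimit_map C G \<alpha> X = (\<Union>(x, a)\<in>X. colimit_rel C G `` {(x, \<alpha> x a)})"


section \<open>Commutation of limits with colimits\<close>

text \<open>For \<open>F : I \<times> J \<rightarrow> Set\<close>: the functors \<open>F(-, j)\<close> and \<open>F(i, -)\<close>, and the functors
  \<open>j \<mapsto> lim\<^sub>i F(i, j)\<close> and \<open>i \<mapsto> colim\<^sub>j F(i, j)\<close>.\<close>

definition fix_snd ::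
    "('j, 'c) cat \<Rightarrow> ('i \<times> 'j, 'b \<times> 'c, 'u) set_fun \<Rightarrow> 'j \<Rightarrow> ('i, 'b, 'u) set_fun" where
  "fix_snd J F j = \<lparr> fobj = (\<lambda>i. fobj F (i, j)), farr = (\<lambda>u. farr F (u, Ident J j)) \<rparr>"

definition fix_fst ::
    "('i, 'b) cat \<Rightarrow> ('i \<times> 'j, 'b \<times> 'c, 'u) set_fun \<Rightarrow> 'i \<Rightarrow> ('j, 'c, 'u) set_fun" where
  "fix_fst I F i = \<lparr> fobj = (\<lambda>j. fobj F (i, j)), farr = (\<lambda>v. farr F (Ident I i, v)) \<rparr>"

definition lim_functor ::
    "('i, 'b) cat \<Rightarrow> ('j, 'c) cat \<Rightarrow> ('i \<times> 'j, 'b \<times> 'c, 'u) set_fun \<Rightarrow> ('j, 'c, 'i \<Rightarrow> 'u) set_fun" where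
  "lim_functor I J F =
    \<lparr> fobj = (\<lambda>j. limit I (fix_snd J F j)),
      farr = (\<lambda>v. limit_map I (\<lambda>i. farr F (Ident I i, v))) \<rparr>"

definition colim_functor ::
    "('i, 'b) cat \<Rightarrow> ('j, 'c) cat \<Rightarrow> ('i \<times> 'j, 'b \<times> 'c, 'u) set_fun \<Rightarrow>
      ('i, 'b, ('j \<times> 'u) set) set_fun" where
  "colim_functor I J F =
    \<lparr> fobj = (\<lambda>i. colimit J (fix_fst I F i)),
      farr = (\<lambda>u. colimit_map J (fix_fst I F (Cod I u)) (\<lambda>j. farr F (u, Ident J j))) \<rparr>"

text \<open>The canonical map \<open>colim\<^sub>j lim\<^sub>i F(i, j) \<rightarrow> lim\<^sub>i colim\<^sub>j F(i, j)\<close>: its component at \<open>i\<close> is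
  induced by the projections \<open>lim\<^sub>i F(i, j) \<rightarrow> F(i, j)\<close>.\<close>

definition canonical_map ::
    "('i, 'b) cat \<Rightarrow> ('j, 'c) cat \<Rightarrow> ('i \<times> 'j, 'b \<times> 'c, 'u) set_fun \<Rightarrow>
      ('j \<times> ('i \<Rightarrow> 'u)) set \<Rightarrow> ('i \<Rightarrow> ('j \<times> 'u) set)" where
  "canonical_map I J F X = (\<lambda>i\<in>Obj I. colimit_map J (fix_fst I F i) (\<lambda>j s. s i) X)"

text \<open>The argument of type \<open>'u itself\<close> records the type whose subsets are the objects of \<open>Set\<close>;
  only the values of \<open>F\<close> are confined to \<open>'u\<close>, the limits and colimits live over larger types. This
  is a category of all sets up to a cardinality bound, so to use it for a category \<open>J\<close> one has to
  require that \<open>J\<close> is small relative to \<open>'u\<close>, namely that \<open>'u\<close> is infinite and \<open>Arr J \<lesssim> UNIV\<close>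
  over \<open>'u\<close> (for a tiny \<open>'u\<close>, such as \<open>unit\<close>, few functors would be tested).\<close>

definition limits_commute_with_colimits ::
    "'u itself \<Rightarrow> ('i, 'b) cat \<Rightarrow> ('j, 'c) cat \<Rightarrow> bool" where
  "limits_commute_with_colimits (U :: 'u itself) I J \<longleftrightarrow>
    (\<forall>F :: ('i \<times> 'j, 'b \<times> 'c, 'u) set_fun. set_functor (prod_cat I J) F \<longrightarrow>
      bij_betw (canonical_map I J F)
        (colimit J (lim_functor I J F)) (limit I (colim_functor I J F)))"

definition colimits_commute_with_pullbacks :: "'u itself \<Rightarrow> ('j, 'c) cat \<Rightarrow> bool" where
  "colimits_commute_with_pullbacks U J \<longleftrightarrow> limits_commute_with_colimits U cospan J"

end

theory Submission
  imports Defs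
begin

text \<open>The colimit of a representable functor is a point. Hence for \<open>f : w \<rightarrow> x\<close> and \<open>g : w \<rightarrow> y\<close> the
  pullback of \<open>Hom(x, -) \<rightarrow> Hom(w, -) \<leftarrow> Hom(y, -)\<close> has a point as its colimit, so it is nonempty
  somewhere: every span can be completed to a commutative square. Pulling back over the constant
  functor \<open>1\<close> instead, one sees that for \<open>f, g : x \<rightarrow> y\<close> the pairs \<open>(f, g)\<close> and \<open>(id, id)\<close> are
  identified in the colimit of \<open>Hom(x, -) \<times> Hom(x, -)\<close>. By the completion of spans, being coequalized
  by some arrow is invariant under this identification, so \<open>f\<close> and \<open>g\<close> are coequalized.\<close>

section \<open>Hom-sets, product categories and the cospan shape\<close>

lemma HomI: "f \<in> Arr C \<Longrightarrow> f \<in> Hom C (Dom C f) (Cod C f)"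
  by (simp add: Hom_def)

lemma Hom_Arr: "f \<in> Hom C x y \<Longrightarrow> f \<in> Arr C"
  by (simp add: Hom_def)

lemma (in category) Hom_Obj:
  "f \<in> Hom C x y \<Longrightarrow> x \<in> Obj C" "f \<in> Hom C x y \<Longrightarrow> y \<in> Obj C"
  using Dom_in Cod_in by (auto simp: Hom_def)

lemma Hom_prod_cat:
  "(u, v) \<in> Hom (prod_cat I J) (i, j) (i', j') \<longleftrightarrow> u \<in> Hom I i i' \<and> v \<in> Hom J j j'"
  by (auto simp: Hom_def prod_cat_def)

lemma prod_cat_simps:
  "Obj (prod_cat I J) = Obj I \<times> Obj J"
  "Ident (prod_cat I J) (i, j) = (Ident I i, Ident J j)"
  "Compose (prod_cat I J) (g, g') (f, f') = (Compose I g f, Compose J g' f')"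
  by (simp_all add: prod_cat_def)

lemma cospan_simps [simp]:
  "Obj cospan = UNIV" "Arr cospan = UNIV" "Dom cospan = cospan_dom" "Cod cospan = cospan_cod"
  "Ident cospan = Idarr" "Compose cospan = cospan_compose"
  by (simp_all add: cospan_def)

lemma category_cospan: "category cospan"
proof
  show "Compose cospan h (Compose cospan g f) = Compose cospan (Compose cospan h g) f"
    if "f \<in> Hom cospan w x" "g \<in> Hom cospan x y" "h \<in> Hom cospan y z" for f g h w x y z
    by (cases h) auto
  show "Compose cospan f (Ident cospan x) = f" if "f \<in> Hom cospan x y" for f x y
    using that by (cases f) (auto simp: Hom_def)
  show "Compose cospan g f \<in> Hom cospan x z"
    if "f \<in> Hom cospan x y" "g \<in> Hom cospan y z" for f g x y z
    using that by (cases g; cases f) (auto simp: Hom_def)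
qed (auto simp: Hom_def)

section \<open>Colimit classes and the maps between them\<close>

lemma equiv_colimit_rel: "equiv UNIV (colimit_rel C F)"
  unfolding colimit_rel_def Let_def
  by (intro equivI sym_rtrancl refl_rtrancl trans_rtrancl sym_Un_converse) simp

lemma colimit_rel_step:
  "f \<in> Hom C x y \<Longrightarrow> a \<in> fobj F x \<Longrightarrow> ((x, a), (y, farr F f a)) \<in> colimit_rel C F"
  by (auto simp: colimit_rel_def Let_def Hom_def)

text \<open>Related elements are joined by a finite zigzag of generating steps, so an invariant need
  only survive one step in either direction.\<close>

lemma colimit_rel_induct [consumes 1, case_names refl forward backward]:
  assumes "(p, q) \<in> colimit_rel C F"
    and "P p"
    and "\<And>f a. f \<in> Arr C \<Longrightarrow> a \<in> fobj F (Dom C f) \<Longrightarrow> P (Dom C f, a) \<Longrightarrow> P (Cod C f, farr F f a)"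
    and "\<And>f a. f \<in> Arr C \<Longrightarrow> a \<in> fobj F (Dom C f) \<Longrightarrow> P (Cod C f, farr F f a) \<Longrightarrow> P (Dom C f, a)"
  shows "P q"
  using assms(1) unfolding colimit_rel_def Let_def
  by (induction rule: rtrancl_induct) (use assms(2-4) in auto)

lemma colimit_classI:
  "x \<in> Obj C \<Longrightarrow> a \<in> fobj F x \<Longrightarrow> colimit_rel C F `` {(x, a)} \<in> colimit C F"
  by (auto simp: colimit_def quotient_def)

text \<open>Naturality turns each generating step for \<open>F\<close> into one for
  \<open>G\<close>, hence zigzags into zigzags. All classes in the union defining
  \<open>colimit_map\<close> therefore coincide, and the map can be computed on a
  representative.\<close>

lemma colimit_map_class:
  assumes maps: "\<And>f a. f \<in> Arr C \<Longrightarrow> a \<in> fobj F (Dom C f) \<Longrightarrow> \<alpha> (Dom C f) a \<in> fobj G (Dom C f)"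
    and nat: "\<And>f a. f \<in> Arr C \<Longrightarrow> a \<in> fobj F (Dom C f) \<Longrightarrow>
      farr G f (\<alpha> (Dom C f) a) = \<alpha> (Cod C f) (farr F f a)"
  shows "colimit_map C G \<alpha> (colimit_rel C F `` {(x, a)}) = colimit_rel C G `` {(x, \<alpha> x a)}"
proof -
  note G = equiv_colimit_rel[of C G]
  have step: "((Dom C f, \<alpha> (Dom C f) a), (Cod C f, \<alpha> (Cod C f) (farr F f a))) \<in> colimit_rel C G"
    if "f \<in> Arr C" "a \<in> fobj F (Dom C f)" for f a
    using colimit_rel_step[OF HomI[OF that(1)] maps[OF that]] nat[OF that] by simp
  have "((x, \<alpha> x a), case q of (y, b) \<Rightarrow> (y, \<alpha> y b)) \<in> colimit_rel C G"
    if "((x, a), q) \<in> colimit_rel C F" for q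
    using that
  proof (induction rule: colimit_rel_induct)
    case refl
    show ?case using equiv_class_self[OF G] by auto
  next
    case (forward f a)
    then show ?case using step[of f a] G by (auto elim: equivE dest: transD)
  next
    case (backward f a)
    then show ?case using step[of f a] G by (auto elim!: equivE dest: transD symD)
  qed
  then have "colimit_rel C G `` {(y, \<alpha> y b)} = colimit_rel C G `` {(x, \<alpha> x a)}"
    if "((x, a), (y, b)) \<in> colimit_rel C F" for y b
    using that equiv_class_eq[OF G] by fastforce
  moreover have "((x, a), (x, a)) \<in> colimit_rel C F"
    using equiv_class_self[OF equiv_colimit_rel] by auto
  ultimately show ?thesis
    unfolding colimit_map_def by blast
qed

text \<open>Both sides of the equation are the action of \<open>(u, v)\<close>, factored in the two
  possible orders. This is the naturality that \<open>colimit_map_class\<close> asks for.\<close>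

lemma set_functor_fix_fst_arrow:
  assumes "category I" "category J" and F: "set_functor (prod_cat I J) F"
    and u: "u \<in> Hom I i i'" and v: "v \<in> Hom J j j'" and a: "a \<in> fobj F (i, j)"
  shows "farr F (u, Ident J j) a \<in> fobj F (i', j)"
    and "farr F (Ident I i', v) (farr F (u, Ident J j) a)
      = farr F (u, Ident J j') (farr F (Ident I i, v) a)"
proof -
  interpret I: category I by fact
  interpret J: category J by fact
  interpret F: set_functor "prod_cat I J" F by fact
  note o = I.Hom_Obj[OF u] J.Hom_Obj[OF v]
  have ids: "Ident I i \<in> Hom I i i" "Ident I i' \<in> Hom I i' i'"
    "Ident J j \<in> Hom J j j" "Ident J j' \<in> Hom J j' j'"
    using I.Ident_in J.Ident_in o by auto
  show "farr F (u, Ident J j) a \<in> fobj F (i', j)"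
    using F.farr_in[OF _ a] u ids by (simp add: Hom_prod_cat)
  have "farr F (Ident I i', v) (farr F (u, Ident J j) a) = farr F (u, v) a"
    using F.farr_Compose[of "(u, Ident J j)" "(i, j)" "(i', j)" "(Ident I i', v)" "(i', j')" a]
      u v a ids by (simp add: Hom_prod_cat prod_cat_simps I.Ident_left J.Ident_right)
  also have "\<dots> = farr F (u, Ident J j') (farr F (Ident I i, v) a)"
    using F.farr_Compose[of "(Ident I i, v)" "(i, j)" "(i, j')" "(u, Ident J j')" "(i', j')" a]
      u v a ids by (simp add: Hom_prod_cat prod_cat_simps I.Ident_right J.Ident_left)
  finally show "farr F (Ident I i', v) (farr F (u, Ident J j) a)
      = farr F (u, Ident J j') (farr F (Ident I i, v) a)" .
qed

lemma colim_functor_class: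
  assumes "category I" "category J" "set_functor (prod_cat I J) F" "u \<in> Hom I i i'"
  shows "farr (colim_functor I J F) u (colimit_rel J (fix_fst I F i) `` {(j, a)})
    = colimit_rel J (fix_fst I F i') `` {(j, farr F (u, Ident J j) a)}"
proof -
  have "Cod I u = i'" using assms(4) by (simp add: Hom_def)
  then show ?thesis
    unfolding colim_functor_def
    using set_functor_fix_fst_arrow[OF assms HomI]
    by (simp, intro colimit_map_class) (auto simp: fix_fst_def)
qed

text \<open>The projections are natural because \<open>lim_functor\<close> acts on families
  componentwise, so \<open>colimit_map_class\<close> applies.\<close>

lemma canonical_map_class:
  assumes "i \<in> Obj I"
  shows "canonical_map I J F (colimit_rel J (lim_functor I J F) `` {(j, s)}) i
    = colimit_rel J (fix_fst I F i) `` {(j, s i)}"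
  unfolding canonical_map_def using assms
  by (simp, intro colimit_map_class)
    (auto simp: fix_fst_def fix_snd_def lim_functor_def limit_def limit_map_def PiE_def)

section \<open>Representable functors and pullbacks of them\<close>

text \<open>This is the representable functor \<open>Hom(x, -)\<close>. Its values must be sets over
  \<open>'u\<close>, so arrows are coded by \<open>e\<close> and decoded by its inverse on
  \<open>Arr C\<close>.\<close>

definition hom_fun :: "('o, 'a) cat \<Rightarrow> ('a \<Rightarrow> 'u) \<Rightarrow> 'o \<Rightarrow> ('o, 'a, 'u) set_fun" where
  "hom_fun C e x = \<lparr> fobj = (\<lambda>z. e ` Hom C x z),
    farr = (\<lambda>v b. e (Compose C v (inv_into (Arr C) e b))) \<rparr>"

lemma farr_hom_fun:
  assumes "inj_on e (Arr C)" "h \<in> Hom C x y"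
  shows "farr (hom_fun C e x') v (e h) = e (Compose C v h)"
  using assms by (simp add: hom_fun_def Hom_Arr)

lemma fobj_hom_fun: "fobj (hom_fun C e x) z = e ` Hom C x z"
  by (simp add: hom_fun_def)

lemma set_functor_hom_fun:
  assumes "category C" and e: "inj_on e (Arr C)"
  shows "set_functor C (hom_fun C e x)"
proof -
  interpret category C by fact
  show ?thesis
  proof
    fix f y z g z' b
    assume f: "f \<in> Hom C y z" and g: "g \<in> Hom C z z'" and "b \<in> fobj (hom_fun C e x) y"
    then obtain h where h: "h \<in> Hom C x y" "b = e h"
      by (auto simp: fobj_hom_fun)
    show "farr (hom_fun C e x) (Compose C g f) b = farr (hom_fun C e x) g (farr (hom_fun C e x) f b)"
      using farr_hom_fun[OF e Compose_in[OF h(1) f]] Compose_assoc[OF h(1) f g]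
      by (simp add: h(2) farr_hom_fun[OF e h(1)])
  qed (auto simp: fobj_hom_fun farr_hom_fun[OF e] Compose_in Ident_left)
qed

text \<open>By Yoneda's lemma a cospan \<open>Hom(x, -) \<rightarrow> M \<leftarrow> Hom(y, -)\<close> is given by elements \<open>m\<close> of \<open>M x\<close>
  and \<open>n\<close> of \<open>M y\<close>. The injection \<open>e\<close> moves the hom-sets into the type of values of \<open>M\<close>.\<close>

locale hom_cospan = category J + set_functor J M
  for J :: "('o, 'a) cat" and M :: "('o, 'a, 'u) set_fun" +
  fixes e :: "'a \<Rightarrow> 'u" and x y :: 'o and m n :: 'u
  assumes inj_e: "inj_on e (Arr J)"
    and x: "x \<in> Obj J" and y: "y \<in> Obj J" and m: "m \<in> fobj M x" and n: "n \<in> fobj M y"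
begin

text \<open>The legs are the Yoneda maps sending \<open>h\<close> to \<open>farr M h m\<close> and
  \<open>k\<close> to \<open>farr M k n\<close>. An arrow \<open>(From_Left, v)\<close> is the move
  along \<open>v\<close> followed by the leg, which is why the decoded arrow is composed with
  \<open>v\<close> before \<open>m\<close> is transported.\<close>

definition diagram :: "(cospan_obj \<times> 'o, cospan_arr \<times> 'a, 'u) set_fun" where
  "diagram =
    \<lparr> fobj = (\<lambda>(i, j). case i of Left \<Rightarrow> e ` Hom J x j | Mid \<Rightarrow> fobj M j | Right \<Rightarrow> e ` Hom J y j),
      farr = (\<lambda>(u, v) b.
        let h = Compose J v (inv_into (Arr J) e b)
        in case u of
          Idarr i \<Rightarrow> (case i of Left \<Rightarrow> e h | Mid \<Rightarrow> farr M v b | Right \<Rightarrow> e h)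
        | From_Left \<Rightarrow> farr M h m
        | From_Right \<Rightarrow> farr M h n) \<rparr>"

lemma fobj_diagram [simp]:
  "fobj diagram (Left, j) = e ` Hom J x j"
  "fobj diagram (Mid, j) = fobj M j"
  "fobj diagram (Right, j) = e ` Hom J y j"
  by (simp_all add: diagram_def)

lemma farr_diagram:
  "farr diagram (Idarr Mid, v) b = farr M v b"
  "h \<in> Arr J \<Longrightarrow> farr diagram (Idarr Left, v) (e h) = e (Compose J v h)"
  "h \<in> Arr J \<Longrightarrow> farr diagram (Idarr Right, v) (e h) = e (Compose J v h)"
  "h \<in> Arr J \<Longrightarrow> farr diagram (From_Left, v) (e h) = farr M (Compose J v h) m"
  "h \<in> Arr J \<Longrightarrow> farr diagram (From_Right, v) (e h) = farr M (Compose J v h) n"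
  using inj_e by (simp_all add: diagram_def)

lemma set_functor_diagram: "set_functor (prod_cat cospan J) diagram"
proof
  fix f p q a
  assume f: "f \<in> Hom (prod_cat cospan J) p q" and a: "a \<in> fobj diagram p"
  obtain u v i j i' j' where eq: "f = (u, v)" "p = (i, j)" "q = (i', j')"
    by (metis surj_pair)
  have uv: "cospan_dom u = i" "cospan_cod u = i'" "v \<in> Hom J j j'"
    using f by (auto simp: eq Hom_prod_cat) (auto simp: Hom_def)
  show "farr diagram f a \<in> fobj diagram q"
    using uv a m n unfolding eq
    by (cases u; cases i)
      (auto simp: farr_diagram Hom_Arr Compose_in intro: farr_in intro!: farr_in[OF Compose_in])
next
  fix p a
  assume p: "p \<in> Obj (prod_cat cospan J)" and a: "a \<in> fobj diagram p"
  obtain i j where eq: "p = (i, j)" by fastforce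
  show "farr diagram (Ident (prod_cat cospan J) p) a = a"
    using p a unfolding eq
    by (cases i) (auto simp: prod_cat_simps farr_diagram Hom_Arr Ident_left farr_Ident)
next
  fix f p q g r a
  assume f: "f \<in> Hom (prod_cat cospan J) p q" and g: "g \<in> Hom (prod_cat cospan J) q r"
    and a: "a \<in> fobj diagram p"
  obtain u v i j u' v' i' j' i'' j'' where eq: "f = (u, v)" "p = (i, j)" "q = (i', j')"
    "g = (u', v')" "r = (i'', j'')"
    by (metis surj_pair)
  have uv: "cospan_dom u = i" "cospan_cod u = i'" "v \<in> Hom J j j'"
      "cospan_dom u' = i'" "v' \<in> Hom J j' j''"
    using f g by (auto simp: eq Hom_prod_cat) (auto simp: Hom_def)
  \<comment> \<open>\<open>mid\<close> treats a leg followed by an arrow over \<open>Mid\<close>; if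
    the leg comes last, the associativity in \<open>hom\<close> is enough.\<close>
  have mid: "farr M (Compose J (Compose J v' v) h) l = farr M v' (farr M (Compose J v h) l)"
    if "h \<in> Hom J z j" "l \<in> fobj M z" for h z l
    using that uv farr_Compose[OF Compose_in[OF that(1) uv(3)] uv(5) that(2)]
      Compose_assoc[OF that(1) uv(3,5)] by simp
  have hom: "Compose J v h \<in> Arr J" "h \<in> Arr J"
      "Compose J (Compose J v' v) h = Compose J v' (Compose J v h)"
    if "h \<in> Hom J z j" for h z
    using Compose_assoc[OF that uv(3,5)] Hom_Arr[OF that] Hom_Arr[OF Compose_in[OF that uv(3)]]
    by simp_all
  show "farr diagram (Compose (prod_cat cospan J) g f) a = farr diagram g (farr diagram f a)"
    using uv(1,2,4) a m n mid hom farr_Compose[OF uv(3,5)] unfolding eq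
    by (cases u; cases u'; cases i) (auto simp: prod_cat_simps farr_diagram)
qed

text \<open>Compatibility along the two legs makes \<open>farr M h m\<close> and
  \<open>farr M k n\<close> both equal to \<open>s Mid\<close>.\<close>

lemma lim_diagramD:
  assumes "s \<in> fobj (lim_functor cospan J diagram) j" and j: "j \<in> Obj J"
  obtains h k where "h \<in> Hom J x j" "k \<in> Hom J y j" "s Left = e h" "s Right = e k"
    "farr M h m = farr M k n"
proof -
  have s: "s i \<in> fobj diagram (i, j)"
      "farr diagram (u, Ident J j) (s (cospan_dom u)) = s (cospan_cod u)" for i u
    using assms(1) by (auto simp: lim_functor_def limit_def fix_snd_def)
  obtain h k where hk: "h \<in> Hom J x j" "k \<in> Hom J y j" "s Left = e h" "s Right = e k"
    using s(1)[of Left] s(1)[of Right] by auto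
  moreover have "farr M h m = farr M k n"
    using s(2)[of From_Left] s(2)[of From_Right] hk
    by (simp add: farr_diagram Hom_Arr[OF hk(1)] Hom_Arr[OF hk(2)] Ident_left)
  ultimately show thesis by (rule that)
qed

text \<open>The point of the pullback with outer components \<open>h\<close> and \<open>k\<close>.
  The middle value is read off the left leg; it fits the right leg exactly when
  \<open>farr M h m = farr M k n\<close>.\<close>

definition lim_pair :: "'a \<Rightarrow> 'a \<Rightarrow> cospan_obj \<Rightarrow> 'u" where
  "lim_pair h k i = (case i of Left \<Rightarrow> e h | Mid \<Rightarrow> farr M h m | Right \<Rightarrow> e k)"

lemma lim_pair_in:
  assumes h: "h \<in> Hom J x j" and k: "k \<in> Hom J y j" and eq: "farr M h m = farr M k n"
  shows "lim_pair h k \<in> fobj (lim_functor cospan J diagram) j"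
proof -
  have in_obj: "lim_pair h k i \<in> fobj diagram (i, j)" for i
    using h k farr_in[OF h m] by (cases i) (auto simp: lim_pair_def)
  have "farr diagram (u, Ident J j) (lim_pair h k (cospan_dom u)) = lim_pair h k (cospan_cod u)" for u
  proof (cases u)
    case (Idarr i)
    have "j \<in> Obj J" using Hom_Obj h by blast
    then show ?thesis
      using set_functor.farr_Ident[OF set_functor_diagram _ in_obj, of i] Idarr
      by (simp add: prod_cat_simps)
  qed (use h k eq in \<open>auto simp: lim_pair_def farr_diagram Hom_Arr Ident_left\<close>)
  then show ?thesis
    using in_obj by (simp add: lim_functor_def limit_def fix_snd_def PiE_UNIV_domain)
qed

text \<open>Every \<open>h\<close> is the image of the identity under \<open>h\<close> itself, so
  the colimit of a representable functor is a point.\<close>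

lemma colimit_rel_Left:
  assumes "h \<in> Hom J x j"
  shows "((x, e (Ident J x)), (j, e h)) \<in> colimit_rel J (fix_fst cospan diagram Left)"
  using colimit_rel_step[OF assms, of "e (Ident J x)" "fix_fst cospan diagram Left"]
    assms Ident_in[OF x]
  by (simp add: fix_fst_def farr_diagram Hom_Arr Ident_right)

lemma colimit_rel_Right:
  assumes "k \<in> Hom J y j"
  shows "((y, e (Ident J y)), (j, e k)) \<in> colimit_rel J (fix_fst cospan diagram Right)"
  using colimit_rel_step[OF assms, of "e (Ident J y)" "fix_fst cospan diagram Right"]
    assms Ident_in[OF y]
  by (simp add: fix_fst_def farr_diagram Hom_Arr Ident_right)

lemma colimit_rel_Mid:
  assumes "h \<in> Hom J z j" "l \<in> fobj M z"
  shows "((z, l), (j, farr M h l)) \<in> colimit_rel J (fix_fst cospan diagram Mid)"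
  using colimit_rel_step[OF assms(1), of l "fix_fst cospan diagram Mid"] assms
  by (auto simp: fix_fst_def farr_diagram)

text \<open>Any two points of the pullback have the same image under the canonical map: the colimits
  over \<open>Left\<close> and \<open>Right\<close> are points, and over \<open>Mid\<close> both
  images are the class of \<open>(x, m)\<close>. Injectivity of that map then identifies their
  classes.\<close>

lemma injectivity:
  assumes "colimits_commute_with_pullbacks TYPE('u) J"
    and h: "h \<in> Hom J x j" "k \<in> Hom J y j" "farr M h m = farr M k n"
    and h': "h' \<in> Hom J x j'" "k' \<in> Hom J y j'" "farr M h' m = farr M k' n"
  shows "((j, lim_pair h k), (j', lim_pair h' k')) \<in> colimit_rel J (lim_functor cospan J diagram)"
proof -
  let ?R = "colimit_rel J (lim_functor cospan J diagram)"
  let ?c = "canonical_map cospan J diagram"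
  have "bij_betw ?c (colimit J (lim_functor cospan J diagram))
      (limit cospan (colim_functor cospan J diagram))"
    using assms(1) set_functor_diagram
    by (simp add: colimits_commute_with_pullbacks_def limits_commute_with_colimits_def)
  then have inj: "inj_on ?c (colimit J (lim_functor cospan J diagram))"
    by (rule bij_betw_imp_inj_on)
  have rel: "((j, lim_pair h k i), (j', lim_pair h' k' i))
      \<in> colimit_rel J (fix_fst cospan diagram i)" for i
  proof -
    obtain p where "(p, (j, lim_pair h k i)) \<in> colimit_rel J (fix_fst cospan diagram i)"
      "(p, (j', lim_pair h' k' i)) \<in> colimit_rel J (fix_fst cospan diagram i)"
    proof (cases i)
      case Left
      then show ?thesis
        using colimit_rel_Left[OF h(1)] colimit_rel_Left[OF h'(1)] that
        by (auto simp: lim_pair_def)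
    next
      case Mid
      then show ?thesis
        using colimit_rel_Mid[OF h(1) m] colimit_rel_Mid[OF h'(1) m] that
        by (auto simp: lim_pair_def)
    next
      case Right
      then show ?thesis
        using colimit_rel_Right[OF h(2)] colimit_rel_Right[OF h'(2)] that
        by (auto simp: lim_pair_def)
    qed
    then show ?thesis
      by (meson equiv_colimit_rel equivE symD transD)
  qed
  have "?c (?R `` {(j, lim_pair h k)}) = ?c (?R `` {(j', lim_pair h' k')})"
  proof
    fix i
    show "?c (?R `` {(j, lim_pair h k)}) i = ?c (?R `` {(j', lim_pair h' k')}) i"
      using equiv_class_eq[OF equiv_colimit_rel rel] by (simp add: canonical_map_class)
  qed
  moreover have "?R `` {(j, lim_pair h k)} \<in> colimit J (lim_functor cospan J diagram)"
    "?R `` {(j', lim_pair h' k')} \<in> colimit J (lim_functor cospan J diagram)"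
    using h h' Hom_Obj by (auto intro!: colimit_classI lim_pair_in)
  ultimately have "?R `` {(j, lim_pair h k)} = ?R `` {(j', lim_pair h' k')}"
    using inj by (simp add: inj_on_eq_iff)
  then show ?thesis
    by (simp add: eq_equiv_class_iff[OF equiv_colimit_rel])
qed

text \<open>The classes of the two identities are sent by the legs to the classes of
  \<open>m\<close> and \<open>n\<close>. As these agree, they form a point of the limit of colimits,
  and a representative of its preimage supplies \<open>h\<close> and \<open>k\<close>.\<close>

lemma surjectivity:
  assumes "colimits_commute_with_pullbacks TYPE('u) J"
    and mn: "((x, m), (y, n)) \<in> colimit_rel J (fix_fst cospan diagram Mid)"
  obtains j h k where "h \<in> Hom J x j" "k \<in> Hom J y j" "farr M h m = farr M k n"
proof -
  let ?cl = "\<lambda>i p. colimit_rel J (fix_fst cospan diagram i) `` {p}"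
  define \<sigma> where "\<sigma> i = (case i of Left \<Rightarrow> ?cl Left (x, e (Ident J x)) | Mid \<Rightarrow> ?cl Mid (x, m)
    | Right \<Rightarrow> ?cl Right (y, e (Ident J y)))" for i
  have ids: "Ident J x \<in> Hom J x x" "Ident J y \<in> Hom J y y"
    using x y Ident_in by auto
  have mn': "?cl Mid (x, m) = ?cl Mid (y, n)"
    using equiv_class_eq[OF equiv_colimit_rel mn] .
  have \<sigma>_in: "\<sigma> i \<in> colimit J (fix_fst cospan diagram i)" for i
    using ids x y m by (cases i) (auto simp: \<sigma>_def fix_fst_def intro!: colimit_classI)
  have "farr (colim_functor cospan J diagram) u (\<sigma> (cospan_dom u)) = \<sigma> (cospan_cod u)" for u
  proof -
    have "u \<in> Hom cospan (cospan_dom u) (cospan_cod u)"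
      by (simp add: Hom_def)
    note cl = colim_functor_class[OF category_cospan category_axioms set_functor_diagram this]
    show ?thesis
    proof (cases u)
      case (Idarr i)
      then show ?thesis
        using cl ids x m by (cases i) (auto simp: \<sigma>_def farr_diagram Hom_Arr Ident_left farr_Ident)
    \<comment> \<open>The right leg leads to the class of \<open>(y, n)\<close>, whereas
      \<open>\<sigma> Mid\<close> was chosen as that of \<open>(x, m)\<close>; \<open>mn'\<close>
      reconciles them.\<close>
    qed (use cl ids x y m n mn' in
      \<open>auto simp: \<sigma>_def farr_diagram Hom_Arr Ident_left farr_Ident\<close>)
  qed
  then have "\<sigma> \<in> limit cospan (colim_functor cospan J diagram)"
    using \<sigma>_in by (simp add: limit_def colim_functor_def PiE_UNIV_domain)
  moreover have "bij_betw (canonical_map cospan J diagram) (colimit J (lim_functor cospan J diagram))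
      (limit cospan (colim_functor cospan J diagram))"
    using assms(1) set_functor_diagram
    by (simp add: colimits_commute_with_pullbacks_def limits_commute_with_colimits_def)
  ultimately obtain X where "X \<in> colimit J (lim_functor cospan J diagram)"
    unfolding bij_betw_def by blast
  then obtain j s where "j \<in> Obj J" "s \<in> fobj (lim_functor cospan J diagram) j"
    by (auto simp: colimit_def quotient_def)
  then show thesis
    using lim_diagramD that by metis
qed

end

section \<open>Completing spans and coequalizing parallel pairs\<close>

text \<open>For \<open>M = Hom(w, -)\<close> with \<open>m\<close> and \<open>n\<close> the codes of
  \<open>f\<close> and \<open>g\<close>, the equation delivered by \<open>surjectivity\<close> is
  the commutative square. Its hypothesis holds since \<open>f\<close> and \<open>g\<close> are both
  related to the identity of \<open>w\<close>.\<close>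

lemma span_completion:
  fixes J :: "('o, 'a) cat" and e :: "'a \<Rightarrow> 'u"
  assumes "category J" and e: "inj_on e (Arr J)"
    and comm: "colimits_commute_with_pullbacks TYPE('u) J"
    and f: "f \<in> Hom J w x" and g: "g \<in> Hom J w y"
  obtains z h k where "h \<in> Hom J x z" "k \<in> Hom J y z" "Compose J h f = Compose J k g"
proof -
  interpret category J by fact
  interpret hom_cospan J "hom_fun J e w" e x y "e f" "e g"
    using assms set_functor_hom_fun[OF assms(1) e] Hom_Obj
    by (auto simp: hom_cospan_def hom_cospan_axioms_def fobj_hom_fun)
  have "Ident J w \<in> Hom J w w" using f Hom_Obj Ident_in by blast
  then have "((w, e (Ident J w)), (z, e h)) \<in> colimit_rel J (fix_fst cospan diagram Mid)"
    if "h \<in> Hom J w z" for h z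
    using colimit_rel_Mid[OF that, of "e (Ident J w)"] that
    by (auto simp: fobj_hom_fun farr_hom_fun[OF e] Ident_right)
  from this[OF f] this[OF g]
  have "((x, e f), (y, e g)) \<in> colimit_rel J (fix_fst cospan diagram Mid)"
    by (meson equiv_colimit_rel equivE symD transD)
  from surjectivity[OF comm this] obtain z h k
    where hk: "h \<in> Hom J x z" "k \<in> Hom J y z"
      "farr (hom_fun J e w) h (e f) = farr (hom_fun J e w) k (e g)" .
  then have "e (Compose J h f) = e (Compose J k g)"
    by (simp add: farr_hom_fun[OF e f] farr_hom_fun[OF e g])
  then have "Compose J h f = Compose J k g"
    using inj_onD[OF e] Compose_in[OF f hk(1)] Compose_in[OF g hk(2)] Hom_Arr by metis
  then show thesis using that hk by blast
qed

lemma parallel_pair_coequalized: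
  fixes J :: "('o, 'a) cat" and e :: "'a \<Rightarrow> 'u"
  assumes "category J" and e: "inj_on e (Arr J)"
    and comm: "colimits_commute_with_pullbacks TYPE('u) J"
    and f: "f \<in> Hom J x y" and g: "g \<in> Hom J x y"
  obtains z h where "h \<in> Hom J y z" "Compose J h f = Compose J h g"
proof -
  interpret category J by fact
  \<comment> \<open>The constant one-point functor, with \<open>undefined\<close> as its point. Over
    it every pair of arrows out of \<open>x\<close> with a common codomain satisfies the pullback
    equation.\<close>
  let ?M = "\<lparr> fobj = \<lambda>_. {undefined}, farr = \<lambda>_ _. undefined \<rparr> :: ('o, 'a, 'u) set_fun"
  have x: "x \<in> Obj J" using f Hom_Obj by blast
  interpret hom_cospan J ?M e x x undefined undefined
    by standard (auto simp: x e)
  have id: "Ident J x \<in> Hom J x x" using x by (rule Ident_in)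
  \<comment> \<open>The induction needs a predicate on all pairs \<open>(j, s)\<close>, so
    \<open>coeq\<close> ranges over every decoding of \<open>s\<close>; injectivity of
    \<open>e\<close> makes the decoding unique in \<open>coeq_iff\<close>.\<close>
  define coeq where "coeq = (\<lambda>(j, s :: cospan_obj \<Rightarrow> 'u). \<forall>h k. h \<in> Hom J x j \<longrightarrow> k \<in> Hom J x j \<longrightarrow>
    s Left = e h \<longrightarrow> s Right = e k \<longrightarrow> (\<exists>z. \<exists>t\<in>Hom J j z. Compose J t h = Compose J t k))"
  have coeq_iff: "coeq (j, s) \<longleftrightarrow> (\<exists>z. \<exists>t\<in>Hom J j z. Compose J t h = Compose J t k)"
    if "h \<in> Hom J x j" "k \<in> Hom J x j" "s Left = e h" "s Right = e k" for j s h k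
  proof -
    have "h' = h \<and> k' = k"
      if "h' \<in> Hom J x j" "k' \<in> Hom J x j" "s Left = e h'" "s Right = e k'" for h' k'
      using that \<open>s Left = e h\<close> \<open>s Right = e k\<close> \<open>h \<in> Hom J x j\<close> \<open>k \<in> Hom J x j\<close>
      by (metis Hom_Arr inj_onD[OF e])
    then show ?thesis
      using that by (auto simp: coeq_def)
  qed
  have step: "coeq (Dom J v, s) \<longleftrightarrow> coeq (Cod J v, farr (lim_functor cospan J diagram) v s)"
    if v: "v \<in> Arr J" and s: "s \<in> fobj (lim_functor cospan J diagram) (Dom J v)" for v s
  proof -
    note v' = HomI[OF v]
    obtain h k where hk: "h \<in> Hom J x (Dom J v)" "k \<in> Hom J x (Dom J v)"
        "s Left = e h" "s Right = e k"
      using lim_diagramD[OF s Dom_in[OF v]] by metis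
    have "farr (lim_functor cospan J diagram) v s Left = e (Compose J v h)"
      "farr (lim_functor cospan J diagram) v s Right = e (Compose J v k)"
      using hk(3,4) Hom_Arr[OF hk(1)] Hom_Arr[OF hk(2)]
      by (simp_all add: lim_functor_def limit_map_def farr_diagram)
    then have iff: "coeq (Cod J v, farr (lim_functor cospan J diagram) v s) \<longleftrightarrow>
      (\<exists>z. \<exists>t\<in>Hom J (Cod J v) z. Compose J t (Compose J v h) = Compose J t (Compose J v k))"
      using hk Compose_in[OF _ v'] by (intro coeq_iff) auto
    show ?thesis
      unfolding iff coeq_iff[OF hk]
    proof safe
      \<comment> \<open>Completing the span of \<open>t\<close> and \<open>v\<close> to
        \<open>p t = q v\<close> gives \<open>q v h = p t h = p t k = q v k\<close>, so
        \<open>q\<close> is the new witness.\<close>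
      fix z t assume t: "t \<in> Hom J (Dom J v) z" and eq: "Compose J t h = Compose J t k"
      obtain z' p q where pq: "p \<in> Hom J z z'" "q \<in> Hom J (Cod J v) z'" "Compose J p t = Compose J q v"
        using span_completion[OF assms(1) e comm t v'] .
      then have "Compose J q (Compose J v h) = Compose J q (Compose J v k)"
        using Compose_assoc[OF _ v' pq(2)] Compose_assoc[OF _ t pq(1)] hk eq by metis
      then show "\<exists>z. \<exists>t\<in>Hom J (Cod J v) z. Compose J t (Compose J v h) = Compose J t (Compose J v k)"
        using pq by blast
    next
      \<comment> \<open>Conversely, the composite of \<open>v\<close> and \<open>t\<close>
        coequalizes \<open>h\<close> and \<open>k\<close>.\<close>
      fix z t assume t: "t \<in> Hom J (Cod J v) z"
        and eq: "Compose J t (Compose J v h) = Compose J t (Compose J v k)"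
      then show "\<exists>z. \<exists>t\<in>Hom J (Dom J v) z. Compose J t h = Compose J t k"
        using Compose_assoc[OF _ v' t] Compose_in[OF v' t] hk by metis
    qed
  qed
  have "((x, lim_pair (Ident J x) (Ident J x)), (y, lim_pair f g))
      \<in> colimit_rel J (lim_functor cospan J diagram)"
    by (intro injectivity comm id f g) simp_all
  then have "coeq (y, lim_pair f g)"
  proof (induction rule: colimit_rel_induct)
    case refl
    show ?case
      using coeq_iff[OF id id] id by (auto simp: lim_pair_def)
  qed (use step in blast)+
  then show thesis
    using coeq_iff[OF f g] that by (auto simp: lim_pair_def)
qed

section \<open>Connected components and filteredness\<close>

lemma connected_rel_step: "f \<in> Hom C x y \<Longrightarrow> (x, y) \<in> connected_rel C"
  by (auto simp: connected_rel_def Let_def Hom_def)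

lemma equiv_connected_rel: "equiv UNIV (connected_rel C)"
  unfolding connected_rel_def Let_def
  by (intro equivI sym_rtrancl refl_rtrancl trans_rtrancl sym_Un_converse) simp

text \<open>Induction along a zigzag from \<open>x\<close>. If the next arrow leaves
  \<open>y\<close>, it forms a span with the arrow from \<open>y\<close> to the current bound, and
  \<open>span\<close> gives a new bound; if it enters \<open>y\<close>, composition keeps the old
  one.\<close>

lemma connected_upper_bound:
  assumes "category C"
    and span: "\<And>w x y f g. f \<in> Hom C w x \<Longrightarrow> g \<in> Hom C w y \<Longrightarrow> \<exists>z. Hom C x z \<noteq> {} \<and> Hom C y z \<noteq> {}"
    and "(x, y) \<in> connected_rel C" "x \<in> Obj C"
  shows "\<exists>z. Hom C x z \<noteq> {} \<and> Hom C y z \<noteq> {}"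
proof -
  interpret category C by fact
  show ?thesis
    using assms(3) unfolding connected_rel_def Let_def
  proof (induction rule: rtrancl_induct)
    case base
    then show ?case using Ident_in[OF assms(4)] by blast
  next
    case (step y y')
    then obtain z a b where ab: "a \<in> Hom C x z" "b \<in> Hom C y z" by blast
    from step(2) consider f where "f \<in> Hom C y y'" | f where "f \<in> Hom C y' y"
      by (auto dest: HomI)
    then show ?case
    proof cases
      case 1
      then obtain z' c d where "c \<in> Hom C z z'" "d \<in> Hom C y' z'"
        using span[OF ab(2)] by blast
      then show ?thesis using Compose_in[OF ab(1)] by blast
    next
      case 2
      then show ?thesis using ab Compose_in[OF 2 ab(2)] by blast
    qed
  qed
qed

lemma Hom_full_subcat: "x \<in> S \<Longrightarrow> y \<in> S \<Longrightarrow> Hom (full_subcat C S) x y = Hom C x y"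
  by (auto simp: full_subcat_def Hom_def)

text \<open>A component contains the codomain of every arrow starting in it. The objects supplied by
  \<open>span\<close> and \<open>coeq\<close> thus stay inside, where the hom-sets are those of
  \<open>C\<close>.\<close>

lemma pseudo_filteredI:
  assumes "category C"
    and span: "\<And>w x y f g. f \<in> Hom C w x \<Longrightarrow> g \<in> Hom C w y \<Longrightarrow> \<exists>z. Hom C x z \<noteq> {} \<and> Hom C y z \<noteq> {}"
    and coeq: "\<And>x y f g. f \<in> Hom C x y \<Longrightarrow> g \<in> Hom C x y \<Longrightarrow>
      \<exists>z. \<exists>h\<in>Hom C y z. Compose C h f = Compose C h g"
  shows "pseudo_filtered C"
  unfolding pseudo_filtered_def
proof
  fix S assume "S \<in> components C"
  interpret category C by fact
  from \<open>S \<in> components C\<close> obtain c where c: "c \<in> Obj C" and S: "S = connected_rel C `` {c}"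
    by (auto simp: components_def quotient_def)
  note eq = equiv_connected_rel[of C]
  have up: "z \<in> S" if "x \<in> S" "f \<in> Hom C x z" for x z f
    using that eq connected_rel_step[OF that(2)] unfolding S by (auto elim!: equivE dest: transD)
  \<comment> \<open>\<open>connected_rel\<close> is a closure over the whole type; a zigzag from the
    object \<open>c\<close> stays among objects because each step ends at an end of an
    arrow.\<close>
  have obj: "x \<in> Obj C" if "x \<in> S" for x
  proof -
    have "(c, x) \<in> connected_rel C" using that S by simp
    then show ?thesis
      unfolding connected_rel_def Let_def
      by (induction rule: rtrancl_induct) (use c Dom_in Cod_in in auto)
  qed
  have simps: "Obj (full_subcat C S) = S" "Compose (full_subcat C S) = Compose C"
    by (simp_all add: full_subcat_def)
  have "c \<in> S" unfolding S using eq by (rule equiv_class_self) simp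
  moreover have "\<exists>z\<in>S. Hom (full_subcat C S) x z \<noteq> {} \<and> Hom (full_subcat C S) y z \<noteq> {}"
    if xy: "x \<in> S" "y \<in> S" for x y
  proof -
    have xy_rel: "(x, y) \<in> connected_rel C"
      using xy eq unfolding S by (auto elim!: equivE dest: transD symD)
    have "\<exists>z. Hom C x z \<noteq> {} \<and> Hom C y z \<noteq> {}"
      by (rule connected_upper_bound[OF assms(1) _ xy_rel obj[OF xy(1)]]) (rule span)
    then obtain z where z: "Hom C x z \<noteq> {}" "Hom C y z \<noteq> {}" by blast
    then have "z \<in> S" using up xy by blast
    then show ?thesis using z xy by (auto simp: Hom_full_subcat)
  qed
  moreover have "\<exists>z\<in>S. \<exists>h\<in>Hom (full_subcat C S) y z. Compose C h f = Compose C h g"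
    if xy: "x \<in> S" "y \<in> S" and fg: "f \<in> Hom (full_subcat C S) x y" "g \<in> Hom (full_subcat C S) x y"
    for x y f g
  proof -
    obtain z h where zh: "h \<in> Hom C y z" "Compose C h f = Compose C h g"
      using coeq[of f x y g] fg xy by (auto simp: Hom_full_subcat)
    then have "z \<in> S" using up xy by blast
    then show ?thesis using zh xy by (auto simp: Hom_full_subcat)
  qed
  ultimately show "filtered (full_subcat C S)"
    unfolding filtered_def simps by blast
qed

theorem lemma2p4:
  fixes J :: "('o, 'a) cat"
  assumes "category J"
    and "infinite (UNIV :: 'u set)"
    and "Arr J \<lesssim> (UNIV :: 'u set)"
    and "colimits_commute_with_pullbacks TYPE('u) J"
  shows "pseudo_filtered J"
proof -
  \<comment> \<open>The size bound on \<open>J\<close> yields the coding that places the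
    representable functors among the functors tested over \<open>'u\<close>.\<close>
  obtain e :: "'a \<Rightarrow> 'u" where e: "inj_on e (Arr J)"
    using assms(3) by (auto simp: lepoll_def)
  show ?thesis
  proof (rule pseudo_filteredI[OF assms(1)])
    show "\<exists>z. Hom J x z \<noteq> {} \<and> Hom J y z \<noteq> {}"
      if "f \<in> Hom J w x" "g \<in> Hom J w y" for w x y f g
      using span_completion[OF assms(1) e assms(4) that] by (metis empty_iff)
    show "\<exists>z. \<exists>h\<in>Hom J y z. Compose J h f = Compose J h g"
      if "f \<in> Hom J x y" "g \<in> Hom J x y" for x y f g
      using parallel_pair_coequalized[OF assms(1) e assms(4) that] by metis
  qed
qed

end
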